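(* Let $k_1=(Q_0+ap)\theta$ and $k_2=(D_0-bp)\theta$. Under the decentralized decision-making model, the equilibrium carbon emission reduction efforts of the farmer and the retailer are $$E_f^{GD*}=\frac{p_c\theta\omega k_1H+\mu_f(2A^{GD}H+B^{GD})}{\lambda_f},\qquad E_r^{GD*}=\frac{\mu_rM^{GD}}{\lambda_r};$$ the equilibrium level of carbon emission reduction is $$H_d^{GD}=\frac{\lambda_r\mu_fB^{GD}+\lambda_f\mu_rM^{GD}}{\lambda_f\lambda_r\delta-2A^{GD}\mu_f\lambda_r-p_c\omega k_1\mu_f\lambda_r};$$ and the optimal profits of the farmer and the retailer are $$V_f^{GD*}=A^{GD}H^2+B^{GD}H+C^{GD},\qquad V_r^{GD*}=M^{GD}H+N^{GD},$$ where $$A^{GD}=\frac{2\rho\lambda_f+4\lambda_f\delta-4\mu_fp_c\omega k_1-\sqrt{\triangle^{GD}}}{8\mu_f^2},$$ $$M^{GD}=\frac{p_rk_2\lambda_f}{p_c\omega k_1\mu_f+2A^{GD}\mu_f^2+\lambda_f\rho-\delta\lambda_f},$$ $$B^{GD}=-\frac{\left(2\lambda_r^2A^{GD}M^{GD}+k_1\lambda_rp_c+k_1\lambda_rp_f\right)\lambda_f}{\lambda_r\left(p_c\omega k_1\mu_f+2A^{GD}\mu_f^2-\lambda_f\rho-\delta\lambda_f\right)},$$ $$C^{GD}=\frac{B^{GD}\left(\lambda_f^2\lambda_rB^{GD}+2M^{GD}\lambda_r^2\lambda_f\right)}{2\lambda_r\lambda_f\rho},$$ $$N^{GD}=\frac{M^{GD}\left(2\lambda_r\mu_f^2B^{GD}+M^{GD}\mu_r^2\lambda_f\right)}{2\lambda_r\lambda_f\rho},$$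 with $$\triangle^{GD}=(4\mu_fp_c\omega k_1-4\lambda_f\delta-2\rho\lambda_f)^2-(4\mu_fp_c\omega k_1)^2>0.$$
   Context: Parameters are real constants: effort cost coefficients $\lambda_f,\lambda_r>0$; impact coefficients $\mu_f,\mu_r>0$ of the efforts on the carbon emission reduction level; $\omega>0$ (impact of the farmer's effort on the carbon sink); consumers' low-carbon preference $\theta>0$; decay coefficient $\delta>0$; profit discount rate $\rho>0$; marginal profits $p_f,p_r\ge 0$ of the farmer and the retailer; unit product price $p\ge 0$; unit carbon sink price $p_c\ge 0$; initial supply and demand $Q_0,D_0\ge 0$; price influence coefficients $a,b>0$. There are two players, a farmer $f$ and a retailer $r$. At time $t\ge 0$ the farmer exerts effort $E_f(t)$ (emission reduction and carbon sequestration) and the retailer exerts effort $E_r(t)$ (low-carbon promotion). The state $H(t)$ is the carbon emission reduction level, with $H(0)\ge 0$ and $$\dot H(t)=\mu_fE_f(t)+\mu_rE_r(t)-\delta H(t).$$ Supply is $Q(t)=(Q_0+ap)\theta H(t)$, demand is $D(t)=(D_0-bp)\theta H(t)$, and the total carbon sink is $(1+\omega E_f(t))Q(t)$. Decentralized model (superscript $GD$): each player maximizes its own discounted profit, $$J_f^{GD}=\int_0^\infty e^{-\rho t}\Big[p_fQ+p_c(1+\omega E_f)Q-\tfrac12\lambda_fE_f^2\Big]dt,\qquad J_r^{GD}=\int_0^\infty e^{-\rho t}\Big[p_rD-\tfrac12\lambda_rE_r^2\Big]dt.$$ The time argument $t$ is omitted. Equilibrium efforts, as functions of the current level $H$, and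 optimal profit functions $V_f^{GD},V_r^{GD}$ of $H$ are determined by the Hamilton-Jacobi-Bellman equations $$\rho V_f^{GD}=\max_{E_f}\Big[p_fQ-\tfrac12\lambda_fE_f^2+p_c(1+\omega E_f)Q+(V_f^{GD})'(\mu_fE_f+\mu_rE_r-\delta H)\Big],$$ $$\rho V_r^{GD}=\max_{E_r}\Big[p_rD-\tfrac12\lambda_rE_r^2+(V_r^{GD})'(\mu_fE_f+\mu_rE_r-\delta H)\Big].$$ The equilibrium level of carbon emission reduction $H_d^{GD}$ is the level of $H$ obtained by setting $\dot H=0$ under the equilibrium efforts.
   Formalization: Misprints corrected: E_f without θ; M = -p_r k_2 λ_f/(… - λ_fρ - δλ_f); B: μ_r² for λ_r²; C: μ_f², μ_r² for λ_f², λ_r²; H_d: μ_f²B, μ_r²M, 2Aμ_f². Δ>0 and nonzero H_d denominator assumed; uniqueness only for quadratic V_f, affine V_r, leading coefficient at most A. *)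

theory Defs
  imports "HOL-Analysis.Analysis"
begin

record game =
  lam_f :: real   (* effort cost coefficients *)
  lam_r :: real
  mu_f :: real    (* impact of the efforts on the emission reduction level *)
  mu_r :: real
  omega :: real   (* impact of the farmer's effort on the carbon sink *)
  theta :: real   (* low-carbon preference of the consumers *)
  delta :: real   (* decay of the emission reduction level *)
  rho :: real     (* discount rate *)
  p_f :: real     (* marginal profits *)
  p_r :: real
  price :: real   (* unit product price *)
  p_c :: real     (* unit carbon sink price *)
  Q0 :: real      (* initial supply and demand *)
  D0 :: real
  coef_a :: real  (* price influence on supply and demand *)
  coef_b :: real

definition valid_game :: "game \<Rightarrow> bool" where
  "valid_game G \<longleftrightarrow>
     lam_f G > 0 \<and> lam_r G > 0 \<and> mu_f G > 0 \<and> mu_r G > 0 \<and> omega G > 0 \<and> theta G > 0 \<and>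
     delta G > 0 \<and> rho G > 0 \<and> p_f G \<ge> 0 \<and> p_r G \<ge> 0 \<and> price G \<ge> 0 \<and> p_c G \<ge> 0 \<and>
     Q0 G \<ge> 0 \<and> D0 G \<ge> 0 \<and> coef_a G > 0 \<and> coef_b G > 0"

definition k1 :: "game \<Rightarrow> real" where
  "k1 G = (Q0 G + coef_a G * price G) * theta G"

definition k2 :: "game \<Rightarrow> real" where
  "k2 G = (D0 G - coef_b G * price G) * theta G"

definition supply_at :: "game \<Rightarrow> real \<Rightarrow> real" where
  "supply_at G H = (Q0 G + coef_a G * price G) * theta G * H"

definition demand_at :: "game \<Rightarrow> real \<Rightarrow> real" where
  "demand_at G H = (D0 G - coef_b G * price G) * theta G * H"

text \<open>Right-hand side of the state equation at level \<open>H\<close> and efforts \<open>ef\<close>, \<open>er\<close>.\<close>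

definition state_rate :: "game \<Rightarrow> real \<Rightarrow> real \<Rightarrow> real \<Rightarrow> real" where
  "state_rate G ef er H = mu_f G * ef + mu_r G * er - delta G * H"

definition profit_f :: "game \<Rightarrow> real \<Rightarrow> real \<Rightarrow> real" where
  "profit_f G ef H =
     p_f G * supply_at G H + p_c G * (1 + omega G * ef) * supply_at G H - 1/2 * lam_f G * ef\<^sup>2"

definition profit_r :: "game \<Rightarrow> real \<Rightarrow> real \<Rightarrow> real" where
  "profit_r G er H = p_r G * demand_at G H - 1/2 * lam_r G * er\<^sup>2"

definition hjb_rhs_f :: "game \<Rightarrow> (real \<Rightarrow> real) \<Rightarrow> real \<Rightarrow> real \<Rightarrow> real \<Rightarrow> real" where
  "hjb_rhs_f G V H er ef = profit_f G ef H + deriv V H * state_rate G ef er H"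

definition hjb_rhs_r :: "game \<Rightarrow> (real \<Rightarrow> real) \<Rightarrow> real \<Rightarrow> real \<Rightarrow> real \<Rightarrow> real" where
  "hjb_rhs_r G V H ef er = profit_r G er H + deriv V H * state_rate G ef er H"

text \<open>
  The coupled Hamilton-Jacobi-Bellman equations of the two players: at every level \<open>H\<close> each
  feedback effort maximizes (over all reals) the right-hand side of that player's equation, the
  effort of the opponent being the opponent's feedback, and the maximum is \<open>\<rho> V H\<close>.
  Differentiability is required because \<open>deriv\<close> is a total operator.
\<close>

definition hjb_equilibrium ::
  "game \<Rightarrow> (real \<Rightarrow> real) \<Rightarrow> (real \<Rightarrow> real) \<Rightarrow> (real \<Rightarrow> real) \<Rightarrow> (real \<Rightarrow> real) \<Rightarrow> bool" where
  "hjb_equilibrium G Vf Vr Ef Er \<longleftrightarrow>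
     (\<forall>H. Vf field_differentiable at H \<and> Vr field_differentiable at H \<and>
          is_arg_max (hjb_rhs_f G Vf H (Er H)) (\<lambda>_. True) (Ef H) \<and>
          rho G * Vf H = hjb_rhs_f G Vf H (Er H) (Ef H) \<and>
          is_arg_max (hjb_rhs_r G Vr H (Ef H)) (\<lambda>_. True) (Er H) \<and>
          rho G * Vr H = hjb_rhs_r G Vr H (Ef H) (Er H))"

text \<open>
  Closed forms. Some of the published formulas are misprinted: \<open>coef_M\<close>, \<open>coef_B\<close>, \<open>coef_C\<close>,
  \<open>effort_f\<close> and \<open>level\<close> are corrected to what the Hamilton-Jacobi-Bellman equations force:
  \<open>coef_M\<close> has \<open>- p\<^sub>r k\<^sub>2 \<lambda>\<^sub>f\<close> over \<open>\<dots> - \<lambda>\<^sub>f \<rho> - \<delta> \<lambda>\<^sub>f\<close> (published: no leading minus and \<open>+ \<lambda>\<^sub>f \<rho>\<close>);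
  \<open>coef_B\<close> has \<open>\<mu>\<^sub>r\<^sup>2\<close> for a published \<open>\<lambda>\<^sub>r\<^sup>2\<close>;
  \<open>coef_C\<close> has \<open>\<mu>\<^sub>f\<^sup>2\<close> and \<open>\<mu>\<^sub>r\<^sup>2\<close> for \<open>\<lambda>\<^sub>f\<^sup>2\<close> and \<open>\<lambda>\<^sub>r\<^sup>2\<close>;
  \<open>effort_f\<close> lacks a factor \<open>\<theta>\<close>, which is already part of \<open>k\<^sub>1\<close>;
  \<open>level\<close> has \<open>\<mu>\<^sub>f\<^sup>2 B\<close>, \<open>\<mu>\<^sub>r\<^sup>2 M\<close> and \<open>2 A \<mu>\<^sub>f\<^sup>2\<close> for \<open>\<mu>\<^sub>f B\<close>, \<open>\<mu>\<^sub>r M\<close> and \<open>2 A \<mu>\<^sub>f\<close>.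
\<close>

definition discr :: "game \<Rightarrow> real" where
  "discr G =
     (4 * mu_f G * p_c G * omega G * k1 G - 4 * lam_f G * delta G - 2 * rho G * lam_f G)\<^sup>2
     - (4 * mu_f G * p_c G * omega G * k1 G)\<^sup>2"

definition coef_A :: "game \<Rightarrow> real" where
  "coef_A G =
     (2 * rho G * lam_f G + 4 * lam_f G * delta G - 4 * mu_f G * p_c G * omega G * k1 G
        - sqrt (discr G))
     / (8 * (mu_f G)\<^sup>2)"

definition coef_M :: "game \<Rightarrow> real" where
  "coef_M G =
     - (p_r G * k2 G * lam_f G
        / (p_c G * omega G * k1 G * mu_f G + 2 * coef_A G * (mu_f G)\<^sup>2
           - lam_f G * rho G - delta G * lam_f G))"

definition coef_B :: "game \<Rightarrow> real" where
  "coef_B G =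
     - ((2 * (mu_r G)\<^sup>2 * coef_A G * coef_M G
           + k1 G * lam_r G * p_c G + k1 G * lam_r G * p_f G) * lam_f G
        / (lam_r G * (p_c G * omega G * k1 G * mu_f G + 2 * coef_A G * (mu_f G)\<^sup>2
                      - lam_f G * rho G - delta G * lam_f G)))"

definition coef_C :: "game \<Rightarrow> real" where
  "coef_C G =
     coef_B G * ((mu_f G)\<^sup>2 * lam_r G * coef_B G + 2 * coef_M G * (mu_r G)\<^sup>2 * lam_f G)
     / (2 * lam_r G * lam_f G * rho G)"

definition coef_N :: "game \<Rightarrow> real" where
  "coef_N G =
     coef_M G * (2 * lam_r G * (mu_f G)\<^sup>2 * coef_B G + coef_M G * (mu_r G)\<^sup>2 * lam_f G)
     / (2 * lam_r G * lam_f G * rho G)"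

definition effort_f :: "game \<Rightarrow> real \<Rightarrow> real" where
  "effort_f G H =
     (p_c G * omega G * k1 G * H + mu_f G * (2 * coef_A G * H + coef_B G)) / lam_f G"

definition effort_r :: "game \<Rightarrow> real \<Rightarrow> real" where
  "effort_r G H = mu_r G * coef_M G / lam_r G"

definition level_denom :: "game \<Rightarrow> real" where
  "level_denom G =
     lam_f G * lam_r G * delta G - 2 * coef_A G * (mu_f G)\<^sup>2 * lam_r G
     - p_c G * omega G * k1 G * mu_f G * lam_r G"

definition level :: "game \<Rightarrow> real" where
  "level G =
     (lam_r G * (mu_f G)\<^sup>2 * coef_B G + lam_f G * (mu_r G)\<^sup>2 * coef_M G) / level_denom G"

definition profit_opt_f :: "game \<Rightarrow> real \<Rightarrow> real" where
  "profit_opt_f G H = coef_A G * H\<^sup>2 + coef_B G * H + coef_C G"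

definition profit_opt_r :: "game \<Rightarrow> real \<Rightarrow> real" where
  "profit_opt_r G H = coef_M G * H + coef_N G"

end

theory Submission
  imports Defs
begin

text \<open>
  Each right-hand side of the Hamilton-Jacobi-Bellman equations is a strictly concave quadratic in
  the effort of the player concerned, so the maximizing effort exists, is unique, and is given by
  the first-order condition (\<open>is_arg_max_concave_quadratic\<close>). If \<open>V\<^sub>f\<close> is quadratic and \<open>V\<^sub>r\<close> is
  affine in \<open>H\<close>, substituting these efforts turns both equations into polynomial identities in \<open>H\<close>.
  Comparing coefficients (\<open>hjb_equilibrium_iff\<close>), the equilibrium condition is equivalent to the two
  effort formulas together with five equations in \<open>A, B, C, M, N\<close>.

  The coefficient of \<open>H\<^sup>2\<close> yields a quadratic equation for \<open>A\<close> alone, of discriminant \<open>\<triangle>\<close>, whose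
  smaller root is \<open>coef_A\<close>; the bound \<open>A \<le> coef_A\<close> therefore selects it. With \<open>A\<close> known, the
  other four equations are triangular: each is linear in \<open>M\<close>, \<open>B\<close>, \<open>C\<close>, \<open>N\<close> in turn. For \<open>M\<close> and
  \<open>B\<close> the leading coefficient is a multiple of
  \<open>\<lambda>\<^sub>f \<rho> + \<delta> \<lambda>\<^sub>f - p\<^sub>c \<omega> k\<^sub>1 \<mu>\<^sub>f - 2 A \<mu>\<^sub>f\<^sup>2\<close>, which equals \<open>\<lambda>\<^sub>f \<rho> / 2 + sqrt \<triangle> / 4 > 0\<close> at
  \<open>A = coef_A\<close> (\<open>linear_coeff_at_coef_A\<close>); for \<open>C\<close> and \<open>N\<close> it is a positive multiple of \<open>\<rho>\<close>. Hence the
  solution exists and is unique. The stationary level is then the zero of an affine function of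
  \<open>H\<close> with slope proportional to \<open>level_denom\<close>.
\<close>

section \<open>Optimal efforts\<close>

lemma is_arg_max_concave_quadratic:
  fixes q r l x :: real
  assumes "l > 0"
  shows "is_arg_max (\<lambda>y. r + q * y - 1/2 * l * y\<^sup>2) (\<lambda>_. True) x \<longleftrightarrow> x = q / l"
proof -
  define f where "f = (\<lambda>y. r + q * y - 1/2 * l * y\<^sup>2)"
  have vertex: "f y = f (q / l) - l / 2 * (y - q / l)\<^sup>2" for y
    using assms by (simp add: f_def field_simps power2_eq_square)
  have "f y \<le> f (q / l)" for y
    using vertex[of y] assms by simp
  moreover have "f y < f (q / l)" if "y \<noteq> q / l" for y
    using vertex[of y] assms that by simp
  ultimately have "is_arg_max f (\<lambda>_. True) x \<longleftrightarrow> x = q / l"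
    unfolding is_arg_max_def by (meson not_le)
  then show ?thesis by (simp add: f_def)
qed

lemma is_arg_max_hjb_rhs_f_iff:
  assumes "lam_f G > 0"
  shows "is_arg_max (hjb_rhs_f G V H er) (\<lambda>_. True) ef \<longleftrightarrow>
         ef = (p_c G * omega G * k1 G * H + mu_f G * deriv V H) / lam_f G"
proof -
  have "hjb_rhs_f G V H er =
      (\<lambda>ef. ((p_f G + p_c G) * k1 G * H + deriv V H * (mu_r G * er - delta G * H))
            + (p_c G * omega G * k1 G * H + mu_f G * deriv V H) * ef - 1/2 * lam_f G * ef\<^sup>2)"
    by (rule ext)
      (simp add: hjb_rhs_f_def profit_f_def supply_at_def k1_def state_rate_def algebra_simps)
  then show ?thesis
    using is_arg_max_concave_quadratic[OF assms] by simp
qed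

lemma is_arg_max_hjb_rhs_r_iff:
  assumes "lam_r G > 0"
  shows "is_arg_max (hjb_rhs_r G V H ef) (\<lambda>_. True) er \<longleftrightarrow> er = mu_r G * deriv V H / lam_r G"
proof -
  have "hjb_rhs_r G V H ef =
      (\<lambda>er. (p_r G * k2 G * H + deriv V H * (mu_f G * ef - delta G * H))
            + mu_r G * deriv V H * er - 1/2 * lam_r G * er\<^sup>2)"
    by (rule ext)
      (simp add: hjb_rhs_r_def profit_r_def demand_at_def k2_def state_rate_def algebra_simps)
  then show ?thesis
    using is_arg_max_concave_quadratic[OF assms] by simp
qed

section \<open>Comparison of coefficients\<close>

lemma quadratic_eq_0_iff:
  fixes a b c :: real
  shows "(\<forall>x. a * x\<^sup>2 + b * x + c = 0) \<longleftrightarrow> a = 0 \<and> b = 0 \<and> c = 0"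
proof
  assume *: "\<forall>x. a * x\<^sup>2 + b * x + c = 0"
  show "a = 0 \<and> b = 0 \<and> c = 0"
    using *[rule_format, of 0] *[rule_format, of 1] *[rule_format, of "-1"] by simp
qed simp

lemma quadratic_field_derivative:
  fixes A B C H :: real
  shows "((\<lambda>H. A * H\<^sup>2 + B * H + C) has_field_derivative 2 * A * H + B) (at H)"
  by (auto intro!: derivative_eq_intros)

lemma affine_field_derivative:
  fixes M N H :: real
  shows "((\<lambda>H. M * H + N) has_field_derivative M) (at H)"
  by (auto intro!: derivative_eq_intros)

text \<open>
  The five coefficient equations are, in this order, those of \<open>H\<^sup>2\<close>, \<open>H\<close>, \<open>1\<close> in the farmer's
  equation and of \<open>H\<close>, \<open>1\<close> in the retailer's, cleared of denominators.
\<close>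

lemma hjb_equilibrium_iff:
  assumes lf: "lam_f G > 0" and lr: "lam_r G > 0"
  defines "u \<equiv> \<lambda>A. p_c G * omega G * k1 G + 2 * A * mu_f G"
  shows "hjb_equilibrium G (\<lambda>H. A * H\<^sup>2 + B * H + C) (\<lambda>H. M * H + N) Ef Er \<longleftrightarrow>
     (\<forall>H. Ef H = (p_c G * omega G * k1 G * H + mu_f G * (2 * A * H + B)) / lam_f G) \<and>
     (\<forall>H. Er H = mu_r G * M / lam_r G) \<and>
     2 * lam_f G * rho G * A = (u A)\<^sup>2 - 4 * lam_f G * delta G * A \<and>
     lam_f G * lam_r G * (rho G + delta G) * B =
       lam_f G * lam_r G * k1 G * (p_f G + p_c G) + lam_r G * mu_f G * u A * B
       + 2 * lam_f G * (mu_r G)\<^sup>2 * A * M \<and>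
     2 * lam_f G * lam_r G * rho G * C =
       lam_r G * (mu_f G)\<^sup>2 * B\<^sup>2 + 2 * lam_f G * (mu_r G)\<^sup>2 * B * M \<and>
     lam_f G * (rho G + delta G) * M = lam_f G * p_r G * k2 G + mu_f G * u A * M \<and>
     2 * lam_f G * lam_r G * rho G * N =
       lam_f G * (mu_r G)\<^sup>2 * M\<^sup>2 + 2 * lam_r G * (mu_f G)\<^sup>2 * M * B"
proof -
  define Vf where "Vf = (\<lambda>H. A * H\<^sup>2 + B * H + C)"
  define Vr where "Vr = (\<lambda>H. M * H + N)"
  define ef where "ef = (\<lambda>H. (p_c G * omega G * k1 G * H + mu_f G * (2 * A * H + B)) / lam_f G)"
  define er where "er = mu_r G * M / lam_r G"
  have diff: "Vf field_differentiable at H" "Vr field_differentiable at H" for H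
    unfolding Vf_def Vr_def field_differentiable_def
    using quadratic_field_derivative affine_field_derivative by blast+
  have dVf: "deriv Vf H = 2 * A * H + B" for H
    unfolding Vf_def by (rule DERIV_imp_deriv[OF quadratic_field_derivative])
  have dVr: "deriv Vr H = M" for H
    unfolding Vr_def by (rule DERIV_imp_deriv[OF affine_field_derivative])
  have foc_f: "lam_f G * ef H = p_c G * omega G * k1 G * H + mu_f G * (2 * A * H + B)" for H
    using lf by (simp add: ef_def)
  have foc_r: "lam_r G * er = mu_r G * M"
    using lr by (simp add: er_def)
  have lr_nz: "lam_r G \<noteq> 0" using lr by simp
  have residual_f: "2 * lam_f G * lam_r G * (rho G * Vf H - hjb_rhs_f G Vf H er (ef H)) =
      lam_r G * (2 * lam_f G * rho G * A - ((u A)\<^sup>2 - 4 * lam_f G * delta G * A)) * H\<^sup>2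
      + 2 * (lam_f G * lam_r G * (rho G + delta G) * B -
       (lam_f G * lam_r G * k1 G * (p_f G + p_c G) + lam_r G * mu_f G * u A * B
       + 2 * lam_f G * (mu_r G)\<^sup>2 * A * M)) * H
      + (2 * lam_f G * lam_r G * rho G * C -
       (lam_r G * (mu_f G)\<^sup>2 * B\<^sup>2 + 2 * lam_f G * (mu_r G)\<^sup>2 * B * M))" for H
  proof -
    have "hjb_rhs_f G Vf H er (ef H) = (p_f G + p_c G) * k1 G * H
        + (2 * A * H + B) * (mu_r G * er - delta G * H)
        + (p_c G * omega G * k1 G * H + mu_f G * (2 * A * H + B)) * ef H - 1/2 * lam_f G * (ef H)\<^sup>2"
      unfolding hjb_rhs_f_def dVf profit_f_def supply_at_def k1_def[symmetric] state_rate_def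
      by (simp add: algebra_simps)
    \<comment> \<open>at the maximizer the terms in the effort add up to half of \<open>\<lambda>\<^sub>f E\<^sub>f\<^sup>2\<close>\<close>
    also have "\<dots> = (p_f G + p_c G) * k1 G * H
        + (2 * A * H + B) * (mu_r G * er - delta G * H) + 1/2 * lam_f G * (ef H)\<^sup>2"
      unfolding foc_f[symmetric] by (simp add: power2_eq_square)
    finally have rhs: "hjb_rhs_f G Vf H er (ef H) = (p_f G + p_c G) * k1 G * H
        + (2 * A * H + B) * (mu_r G * er - delta G * H) + 1/2 * lam_f G * (ef H)\<^sup>2" .
    have "2 * lam_f G * lam_r G * (rho G * Vf H - hjb_rhs_f G Vf H er (ef H)) =
        2 * lam_f G * lam_r G * (rho G * Vf H - (p_f G + p_c G) * k1 G * H
          + (2 * A * H + B) * delta G * H)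
        - 2 * lam_f G * (2 * A * H + B) * mu_r G * (lam_r G * er) - lam_r G * (lam_f G * ef H)\<^sup>2"
      unfolding rhs by (simp add: algebra_simps power2_eq_square)
    then show ?thesis
      unfolding foc_f foc_r Vf_def u_def by (simp add: algebra_simps power2_eq_square)
  qed
  have residual_r: "2 * lam_f G * lam_r G * (rho G * Vr H - hjb_rhs_r G Vr H (ef H) er) =
      0 * H\<^sup>2 + 2 * lam_r G * (lam_f G * (rho G + delta G) * M
        - (lam_f G * p_r G * k2 G + mu_f G * u A * M)) * H
      + (2 * lam_f G * lam_r G * rho G * N -
        (lam_f G * (mu_r G)\<^sup>2 * M\<^sup>2 + 2 * lam_r G * (mu_f G)\<^sup>2 * M * B))" for H
  proof -
    have "2 * lam_f G * lam_r G * (rho G * Vr H - hjb_rhs_r G Vr H (ef H) er) =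
        2 * lam_f G * lam_r G * (rho G * Vr H - p_r G * k2 G * H + M * delta G * H)
        - 2 * lam_r G * M * mu_f G * (lam_f G * ef H)
        - 2 * lam_f G * M * mu_r G * (lam_r G * er) + lam_f G * (lam_r G * er)\<^sup>2"
      unfolding hjb_rhs_r_def dVr profit_r_def demand_at_def k2_def[symmetric] state_rate_def
      by (simp add: algebra_simps power2_eq_square)
    then show ?thesis
      unfolding foc_f foc_r Vr_def u_def by (simp add: algebra_simps power2_eq_square)
  qed
  have hjb_f: "(\<forall>H. rho G * Vf H = hjb_rhs_f G Vf H er (ef H)) \<longleftrightarrow>
     2 * lam_f G * rho G * A = (u A)\<^sup>2 - 4 * lam_f G * delta G * A \<and>
     lam_f G * lam_r G * (rho G + delta G) * B =
       lam_f G * lam_r G * k1 G * (p_f G + p_c G) + lam_r G * mu_f G * u A * B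
       + 2 * lam_f G * (mu_r G)\<^sup>2 * A * M \<and>
     2 * lam_f G * lam_r G * rho G * C =
       lam_r G * (mu_f G)\<^sup>2 * B\<^sup>2 + 2 * lam_f G * (mu_r G)\<^sup>2 * B * M"
  proof -
    have "(\<forall>H. rho G * Vf H = hjb_rhs_f G Vf H er (ef H)) \<longleftrightarrow>
        (\<forall>H. 2 * lam_f G * lam_r G * (rho G * Vf H - hjb_rhs_f G Vf H er (ef H)) = 0)"
      using lf lr by simp
    then show ?thesis
      unfolding residual_f quadratic_eq_0_iff using lr_nz
      by (simp only: mult_eq_0_iff right_minus_eq zero_neq_numeral[THEN not_sym] simp_thms)
  qed
  have hjb_r: "(\<forall>H. rho G * Vr H = hjb_rhs_r G Vr H (ef H) er) \<longleftrightarrow>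
     lam_f G * (rho G + delta G) * M = lam_f G * p_r G * k2 G + mu_f G * u A * M \<and>
     2 * lam_f G * lam_r G * rho G * N =
       lam_f G * (mu_r G)\<^sup>2 * M\<^sup>2 + 2 * lam_r G * (mu_f G)\<^sup>2 * M * B"
  proof -
    have "(\<forall>H. rho G * Vr H = hjb_rhs_r G Vr H (ef H) er) \<longleftrightarrow>
        (\<forall>H. 2 * lam_f G * lam_r G * (rho G * Vr H - hjb_rhs_r G Vr H (ef H) er) = 0)"
      using lf lr by simp
    then show ?thesis
      unfolding residual_r quadratic_eq_0_iff using lr_nz
      by (simp only: mult_eq_0_iff right_minus_eq zero_neq_numeral[THEN not_sym] simp_thms)
  qed
  have "hjb_equilibrium G Vf Vr Ef Er \<longleftrightarrow>
      (\<forall>H. Ef H = ef H) \<and> (\<forall>H. Er H = er) \<and>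
      (\<forall>H. rho G * Vf H = hjb_rhs_f G Vf H er (ef H)) \<and>
      (\<forall>H. rho G * Vr H = hjb_rhs_r G Vr H (ef H) er)"
    unfolding hjb_equilibrium_def is_arg_max_hjb_rhs_f_iff[OF lf] is_arg_max_hjb_rhs_r_iff[OF lr]
      dVf dVr ef_def[symmetric] er_def[symmetric]
    using diff by (auto simp: ef_def er_def)
  then show ?thesis
    unfolding hjb_f hjb_r unfolding Vf_def Vr_def ef_def er_def by simp
qed

section \<open>Solution of the coefficient equations\<close>

lemma linear_coeff_at_coef_A:
  assumes "mu_f G > 0"
  shows "p_c G * omega G * k1 G * mu_f G + 2 * coef_A G * (mu_f G)\<^sup>2
           - lam_f G * rho G - delta G * lam_f G
         = - (lam_f G * rho G / 2 + sqrt (discr G) / 4)"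
  using assms by (simp add: coef_A_def field_simps)

text \<open>
  Completing the square: the \<open>H\<^sup>2\<close> coefficient equation says that an affine function of \<open>A\<close> with
  positive slope has square \<open>\<triangle>\<close>; \<open>coef_A\<close> is the root at which that function is \<open>- sqrt \<triangle>\<close>.
\<close>

lemma riccati_iff:
  assumes "mu_f G > 0"
  shows "2 * lam_f G * rho G * A
           = (p_c G * omega G * k1 G + 2 * A * mu_f G)\<^sup>2 - 4 * lam_f G * delta G * A \<longleftrightarrow>
         (8 * (mu_f G)\<^sup>2 * A + 4 * mu_f G * p_c G * omega G * k1 G
            - 4 * lam_f G * delta G - 2 * rho G * lam_f G)\<^sup>2 = discr G"
proof -
  have "(8 * (mu_f G)\<^sup>2 * A + 4 * mu_f G * p_c G * omega G * k1 G
            - 4 * lam_f G * delta G - 2 * rho G * lam_f G)\<^sup>2 - discr G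
      = 16 * (mu_f G)\<^sup>2 * ((p_c G * omega G * k1 G + 2 * A * mu_f G)\<^sup>2
          - 4 * lam_f G * delta G * A - 2 * lam_f G * rho G * A)"
    unfolding discr_def by algebra
  then show ?thesis using assms by auto
qed

lemma riccati_smaller_root_iff:
  assumes mf: "mu_f G > 0" and D: "discr G \<ge> 0"
  shows "2 * lam_f G * rho G * A
             = (p_c G * omega G * k1 G + 2 * A * mu_f G)\<^sup>2 - 4 * lam_f G * delta G * A
           \<and> A \<le> coef_A G
         \<longleftrightarrow> A = coef_A G"
proof -
  define z where "z = 8 * (mu_f G)\<^sup>2 * A + 4 * mu_f G * p_c G * omega G * k1 G
            - 4 * lam_f G * delta G - 2 * rho G * lam_f G"
  have shift: "z + sqrt (discr G) = 8 * (mu_f G)\<^sup>2 * (A - coef_A G)"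
    using mf by (simp add: z_def coef_A_def field_simps)
  have le: "A \<le> coef_A G \<longleftrightarrow> z \<le> - sqrt (discr G)"
  proof -
    have "A \<le> coef_A G \<longleftrightarrow> 8 * (mu_f G)\<^sup>2 * (A - coef_A G) \<le> 0"
      using mf by (simp add: mult_le_0_iff)
    then show ?thesis using shift by linarith
  qed
  have eq: "A = coef_A G \<longleftrightarrow> z = - sqrt (discr G)"
    using shift mf by (auto simp: add_eq_0_iff)
  have "z\<^sup>2 = discr G \<longleftrightarrow> z = sqrt (discr G) \<or> z = - sqrt (discr G)"
    using D by (metis power2_eq_iff real_sqrt_pow2)
  moreover have "sqrt (discr G) \<ge> 0" using D by simp
  ultimately have "z\<^sup>2 = discr G \<and> z \<le> - sqrt (discr G) \<longleftrightarrow> z = - sqrt (discr G)"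
    by auto
  then show ?thesis
    unfolding riccati_iff[OF mf] le eq z_def[symmetric] .
qed

lemma mult_eq_minus_iff:
  fixes x d n :: real
  assumes "d \<noteq> 0"
  shows "x * d = - n \<longleftrightarrow> x = - (n / d)"
  using assms by (auto simp: field_simps)

text \<open>
  At \<open>A = coef_A\<close> the remaining four coefficient equations have exactly one solution: the equation
  of \<open>M\<close> contains no other unknown, that of \<open>B\<close> only \<open>M\<close>, and those of \<open>C\<close> and \<open>N\<close> only \<open>M\<close> and \<open>B\<close>.
\<close>

lemma coefficient_equations_iff:
  assumes lf: "lam_f G > 0" and lr: "lam_r G > 0" and mf: "mu_f G > 0" and rho: "rho G > 0"
    and D: "discr G \<ge> 0"
  defines "u \<equiv> p_c G * omega G * k1 G + 2 * coef_A G * mu_f G"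
  shows "lam_f G * lam_r G * (rho G + delta G) * B =
       lam_f G * lam_r G * k1 G * (p_f G + p_c G) + lam_r G * mu_f G * u * B
       + 2 * lam_f G * (mu_r G)\<^sup>2 * coef_A G * M \<and>
     2 * lam_f G * lam_r G * rho G * C =
       lam_r G * (mu_f G)\<^sup>2 * B\<^sup>2 + 2 * lam_f G * (mu_r G)\<^sup>2 * B * M \<and>
     lam_f G * (rho G + delta G) * M = lam_f G * p_r G * k2 G + mu_f G * u * M \<and>
     2 * lam_f G * lam_r G * rho G * N =
       lam_f G * (mu_r G)\<^sup>2 * M\<^sup>2 + 2 * lam_r G * (mu_f G)\<^sup>2 * M * B
     \<longleftrightarrow> M = coef_M G \<and> B = coef_B G \<and> C = coef_C G \<and> N = coef_N G"
    (is "?eqB \<and> ?eqC \<and> ?eqM \<and> ?eqN \<longleftrightarrow> _")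
proof -
  define K where "K = p_c G * omega G * k1 G * mu_f G + 2 * coef_A G * (mu_f G)\<^sup>2
           - lam_f G * rho G - delta G * lam_f G"
  have "K = - (lam_f G * rho G / 2 + sqrt (discr G) / 4)"
    unfolding K_def by (rule linear_coeff_at_coef_A[OF mf])
  moreover have "lam_f G * rho G / 2 + sqrt (discr G) / 4 > 0"
    using lf rho D by (simp add: add_pos_nonneg)
  ultimately have K: "K \<noteq> 0" by simp
  have uK: "mu_f G * u = K + lam_f G * (rho G + delta G)"
    by (simp add: u_def K_def algebra_simps power2_eq_square)
  have M: "?eqM \<longleftrightarrow> M = coef_M G"
  proof -
    have "?eqM \<longleftrightarrow> M * K = - (p_r G * k2 G * lam_f G)"
      unfolding uK by (auto simp: algebra_simps)
    also have "\<dots> \<longleftrightarrow> M = coef_M G"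
      unfolding coef_M_def K_def[symmetric] using K by (simp add: mult_eq_minus_iff)
    finally show ?thesis .
  qed
  have B: "?eqB \<longleftrightarrow> B = coef_B G" if "M = coef_M G"
  proof -
    have "lam_r G * mu_f G * u * B = lam_r G * (K + lam_f G * (rho G + delta G)) * B"
      by (simp add: uK[symmetric])
    then have "?eqB \<longleftrightarrow> B * (lam_r G * K) = - ((2 * (mu_r G)\<^sup>2 * coef_A G * coef_M G
           + k1 G * lam_r G * p_c G + k1 G * lam_r G * p_f G) * lam_f G)"
      unfolding that by (auto simp: algebra_simps)
    also have "\<dots> \<longleftrightarrow> B = coef_B G"
      unfolding coef_B_def K_def[symmetric] using K lr by (simp add: mult_eq_minus_iff)
    finally show ?thesis .
  qed
  have C: "?eqC \<longleftrightarrow> C = coef_C G" if "M = coef_M G" "B = coef_B G"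
    unfolding coef_C_def that using lf lr rho
    by (auto simp: field_simps power2_eq_square)
  have N: "?eqN \<longleftrightarrow> N = coef_N G" if "M = coef_M G" "B = coef_B G"
    unfolding coef_N_def that using lf lr rho
    by (auto simp: field_simps power2_eq_square)
  show ?thesis using M B C N by blast
qed

section \<open>Stationary level and equilibrium\<close>

lemma state_rate_equilibrium_efforts:
  assumes "lam_f G > 0" "lam_r G > 0"
  shows "lam_f G * lam_r G * state_rate G (effort_f G H) (effort_r G H) H =
         lam_r G * (mu_f G)\<^sup>2 * coef_B G + lam_f G * (mu_r G)\<^sup>2 * coef_M G - level_denom G * H"
  using assms
  by (simp add: state_rate_def effort_f_def effort_r_def level_denom_def field_simps power2_eq_square)

theorem proposition1:
  fixes G :: game
  assumes "valid_game G"
    and "discr G > 0"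
  shows "hjb_equilibrium G (profit_opt_f G) (profit_opt_r G) (effort_f G) (effort_r G) \<and>
         (\<forall>A B C M N Ef Er.
            hjb_equilibrium G (\<lambda>H. A * H\<^sup>2 + B * H + C) (\<lambda>H. M * H + N) Ef Er \<and> A \<le> coef_A G \<longrightarrow>
              (\<lambda>H. A * H\<^sup>2 + B * H + C) = profit_opt_f G \<and> (\<lambda>H. M * H + N) = profit_opt_r G \<and>
              Ef = effort_f G \<and> Er = effort_r G) \<and>
         (level_denom G \<noteq> 0 \<longrightarrow>
            (\<forall>H. state_rate G (effort_f G H) (effort_r G H) H = 0 \<longleftrightarrow> H = level G))"
proof -
  have pos: "lam_f G > 0" "lam_r G > 0" "mu_f G > 0" "rho G > 0" and D: "discr G \<ge> 0"
    using assms by (auto simp: valid_game_def)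
  note eqs = hjb_equilibrium_iff[OF pos(1,2)]
  note coeffs = coefficient_equations_iff[OF pos D]
  note root = riccati_smaller_root_iff[OF pos(3) D]
  have Vf: "profit_opt_f G = (\<lambda>H. coef_A G * H\<^sup>2 + coef_B G * H + coef_C G)"
    and Vr: "profit_opt_r G = (\<lambda>H. coef_M G * H + coef_N G)"
    by (auto simp: profit_opt_f_def profit_opt_r_def)
  have equilibrium: "hjb_equilibrium G (profit_opt_f G) (profit_opt_r G) (effort_f G) (effort_r G)"
    unfolding Vf Vr eqs
    using root[of "coef_A G"] coeffs[of "coef_B G" "coef_M G" "coef_C G" "coef_N G"]
    by (simp add: effort_f_def effort_r_def)
  have unique: "(\<lambda>H. A * H\<^sup>2 + B * H + C) = profit_opt_f G \<and> (\<lambda>H. M * H + N) = profit_opt_r G \<and>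
      Ef = effort_f G \<and> Er = effort_r G"
    if eq: "hjb_equilibrium G (\<lambda>H. A * H\<^sup>2 + B * H + C) (\<lambda>H. M * H + N) Ef Er"
      and le: "A \<le> coef_A G" for A B C M N Ef Er
  proof -
    note sys = eq[unfolded eqs]
    have A: "A = coef_A G" using root[of A] sys le by blast
    have "M = coef_M G \<and> B = coef_B G \<and> C = coef_C G \<and> N = coef_N G"
      using sys coeffs[of B M C N] unfolding A by blast
    then show ?thesis
      using sys A by (auto simp: Vf Vr effort_f_def effort_r_def)
  qed
  have "state_rate G (effort_f G H) (effort_r G H) H = 0 \<longleftrightarrow> H = level G"
    if "level_denom G \<noteq> 0" for H
  proof -
    have "state_rate G (effort_f G H) (effort_r G H) H = 0 \<longleftrightarrow>
        lam_f G * lam_r G * state_rate G (effort_f G H) (effort_r G H) H = 0"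
      using pos by simp
    also have "\<dots> \<longleftrightarrow> H = level G"
      unfolding state_rate_equilibrium_efforts[OF pos(1,2)] level_def
      using that by (auto simp: field_simps)
    finally show ?thesis .
  qed
  with equilibrium unique show ?thesis by blast
qed

end
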